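(* Let $X_1,X_2,\dots,X_N$ be independent random variables, with $X_i$ taking values in $[a_i,b_i]$ for $i\in\{1,2,\dots,N\}$, and let $S_N=X_1+X_2+\cdots+X_N$. Suppose $0<\lambda_1<\lambda_2<\cdots<\lambda_n<\infty$. Then $$\sum_{k=1}^{n}\left[e^{(\lambda_k-\lambda_1)\frac{4\lambda_1}{\sum_{i=1}^{N}(b_i-a_i)^2}}-e^{(\lambda_{k-1}-\lambda_1)\frac{4\lambda_1}{\sum_{i=1}^{N}(b_i-a_i)^2}}\right]\mathbb{P}\left[S_N-\mathbb{E}(S_N)\ge\lambda_k\right]\le e^{-\frac{2\lambda_1^2}{\sum_{i=1}^{N}(b_i-a_i)^2}},$$ where $\lambda_0=-\infty$.
   Context: The random variables are real-valued and defined on a probability space with probability $\mathbb{P}$; $\mathbb{E}$ denotes expectation. With $\lambda_0=-\infty$, the second exponential in the $k=1$ term is read as $e^{-\infty}=0$. *)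

theory Defs
  imports "HOL-Probability.Probability"
begin

end

theory Submission
  imports Defs "HOL-Probability.Hoeffding"
begin

text \<open>
  Chernoff's method bounds a single tail probability by replacing the indicator of
  \<open>{x. \<lambda> \<le> x}\<close> with an exponential that dominates it. For \<open>s > 0\<close> the function
  \<open>g x = exp ((x - \<lambda>\<^sub>1) * s)\<close> exceeds the indicator of \<open>{x. \<lambda>\<^sub>1 \<le> x}\<close> by far when \<open>x\<close> is large,
  and the refinement consists in using up this slack. The best step function below \<open>g\<close> that jumps
  only at \<open>\<lambda>\<^sub>1 < \<dots> < \<lambda>\<^sub>n\<close> takes the value \<open>g \<lambda>\<^sub>k\<close> on \<open>[\<lambda>\<^sub>k, \<lambda>\<^sub>k\<^sub>+\<^sub>1)\<close>; its jump at \<open>\<lambda>\<^sub>k\<close> is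
  \<open>g \<lambda>\<^sub>k - g \<lambda>\<^sub>k\<^sub>-\<^sub>1\<close>, the coefficient of the \<open>k\<close>-th tail probability. Taking expectations of
  \<open>step function \<le> g\<close> at \<open>Y = S - E S\<close> bounds the weighted sum of tail probabilities by
  \<open>E (g Y)\<close> (\<open>weighted_tail_sum_le_expectation\<close>).

  With \<open>D = (\<Sum>i. (b\<^sub>i - a\<^sub>i)\<^sup>2)\<close>, Hoeffding's lemma and independence yield
  \<open>E (exp (s * Y)) \<le> exp (s\<^sup>2 * D / 8)\<close> (\<open>expectation_exp_centred_sum_le\<close>), hence
  \<open>E (g Y) \<le> exp (s\<^sup>2 * D / 8 - s * \<lambda>\<^sub>1)\<close>. The exponent is minimal at \<open>s = 4 * \<lambda>\<^sub>1 / D\<close>, where it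
  equals \<open>- 2 * \<lambda>\<^sub>1\<^sup>2 / D\<close>.
\<close>

text \<open>
  If \<open>x\<close> lies beyond the last threshold, all indicators are \<open>1\<close> and the jumps telescope to
  \<open>g (t n) \<le> g x\<close>; otherwise the last term vanishes and can be dropped.
\<close>
lemma sum_jumps_le:
  fixes t :: "nat \<Rightarrow> real" and g :: "real \<Rightarrow> real"
  assumes "mono_on {1..n} t" and "mono g" and "\<And>y. g y \<ge> 0"
  shows "(\<Sum>k=1..n. (g (t k) - (if k = 1 then 0 else g (t (k - 1)))) * of_bool (t k \<le> x)) \<le> g x"
  using assms(1)
proof (induction n)
  case 0
  then show ?case using assms(3) by simp
next
  case (Suc n)
  show ?case
  proof (cases "t (Suc n) \<le> x")
    case True
    have "t k \<le> x" if "k \<in> {1..Suc n}" for k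
      using mono_onD[OF Suc.prems, of k "Suc n"] that True by fastforce
    then have "(\<Sum>k=1..Suc n. (g (t k) - (if k = 1 then 0 else g (t (k - 1)))) * of_bool (t k \<le> x))
        = (\<Sum>k=1..Suc n. g (t k) - (if k = 1 then 0 else g (t (k - 1))))"
      by (intro sum.cong) auto
    also have "\<dots> = g (t (Suc n))"
      by (induction n) auto
    also have "\<dots> \<le> g x"
      using True assms(2) by (simp add: monoD)
    finally show ?thesis .
  next
    case False
    have "mono_on {1..n} t"
      using Suc.prems by (rule mono_on_subset) auto
    then show ?thesis
      using Suc.IH False by simp
  qed
qed

text \<open>
  Markov's inequality is the case \<open>n = 1\<close>, up to division by \<open>g (t 1)\<close>.
\<close>
lemma (in prob_space) weighted_tail_sum_le_expectation:
  fixes t :: "nat \<Rightarrow> real" and g :: "real \<Rightarrow> real" and Y :: "'a \<Rightarrow> real"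
  assumes "mono_on {1..n} t" and "mono g" and "\<And>y. g y \<ge> 0"
    and [measurable]: "random_variable borel Y"
    and "integrable M (\<lambda>\<omega>. g (Y \<omega>))"
  shows "(\<Sum>k=1..n. (g (t k) - (if k = 1 then 0 else g (t (k - 1)))) * prob {\<omega> \<in> space M. t k \<le> Y \<omega>})
         \<le> expectation (\<lambda>\<omega>. g (Y \<omega>))"
proof -
  let ?c = "\<lambda>k. g (t k) - (if k = 1 then 0 else g (t (k - 1)))"
  have int: "integrable M (indicat_real {\<omega> \<in> space M. t k \<le> Y \<omega>})" for k
    by (intro integrable_real_indicator) (auto simp: emeasure_eq_measure)
  have "(\<Sum>k=1..n. ?c k * prob {\<omega> \<in> space M. t k \<le> Y \<omega>})
      = (\<Sum>k=1..n. ?c k * expectation (indicat_real {\<omega> \<in> space M. t k \<le> Y \<omega>}))"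
    by (simp add: Int_absorb2 Collect_restrict)
  also have "\<dots> = expectation (\<lambda>\<omega>. \<Sum>k=1..n. ?c k * indicat_real {\<omega> \<in> space M. t k \<le> Y \<omega>} \<omega>)"
    using int by (subst Bochner_Integration.integral_sum) auto
  also have "\<dots> \<le> expectation (\<lambda>\<omega>. g (Y \<omega>))"
  proof (rule integral_mono)
    show "integrable M (\<lambda>\<omega>. \<Sum>k=1..n. ?c k * indicat_real {\<omega> \<in> space M. t k \<le> Y \<omega>} \<omega>)"
      using int by (intro Bochner_Integration.integrable_sum integrable_mult_right)
  next
    fix \<omega> assume "\<omega> \<in> space M"
    then have "(\<Sum>k=1..n. ?c k * indicat_real {\<omega> \<in> space M. t k \<le> Y \<omega>} \<omega>)
        = (\<Sum>k=1..n. ?c k * of_bool (t k \<le> Y \<omega>))"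
      by (intro sum.cong) (auto simp: indicator_def)
    also have "\<dots> \<le> g (Y \<omega>)"
      by (rule sum_jumps_le) (use assms in auto)
    finally show "(\<Sum>k=1..n. ?c k * indicat_real {\<omega> \<in> space M. t k \<le> Y \<omega>} \<omega>) \<le> g (Y \<omega>)" .
  qed fact
  finally show ?thesis .
qed

text \<open>
  By independence the expectation of the exponential factors into the moment generating functions
  of the centred summands, and Hoeffding's lemma bounds each factor. The argument runs with
  nonnegative integrals, so that integrability is part of the conclusion.
\<close>
lemma (in indep_interval_bounded_random_variables) expectation_exp_centred_sum_le:
  assumes "s \<ge> 0"
  defines "Z \<equiv> \<lambda>\<omega>. exp (s * (\<Sum>i\<in>I. X i \<omega> - expectation (X i)))"
  shows "integrable M Z" and "expectation Z \<le> exp (s\<^sup>2 * (\<Sum>i\<in>I. (b i - a i)\<^sup>2) / 8)"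
proof -
  have [measurable]: "Z \<in> borel_measurable M"
    unfolding Z_def by measurable
  have factor: "(\<integral>\<^sup>+\<omega>. ennreal (exp (s * (X i \<omega> - expectation (X i)))) \<partial>M)
      \<le> ennreal (exp (s\<^sup>2 * (b i - a i)\<^sup>2 / 8))" if "i \<in> I" for i
  proof (cases "s = 0")
    case True
    then show ?thesis by (simp add: emeasure_space_1)
  next
    case False
    interpret interval_bounded_random_variable M "X i" "a i" "b i"
      using that by (rule bounded_random_variable)
    show ?thesis
      by (rule Hoeffdings_lemma_nn_integral) (use False assms(1) in simp)
  qed
  have "(\<integral>\<^sup>+\<omega>. ennreal (Z \<omega>) \<partial>M)
      = (\<integral>\<^sup>+\<omega>. (\<Prod>i\<in>I. ennreal (exp (s * (X i \<omega> - expectation (X i))))) \<partial>M)"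
    unfolding Z_def by (simp add: sum_distrib_left exp_sum fin prod_ennreal)
  also have "\<dots> = (\<Prod>i\<in>I. \<integral>\<^sup>+\<omega>. ennreal (exp (s * (X i \<omega> - expectation (X i)))) \<partial>M)"
    by (intro indep_vars_nn_integral fin indep_vars_compose2[OF indep]) auto
  also have "\<dots> \<le> (\<Prod>i\<in>I. ennreal (exp (s\<^sup>2 * (b i - a i)\<^sup>2 / 8)))"
    by (intro prod_mono_ennreal factor)
  also have "\<dots> = ennreal (exp (s\<^sup>2 * (\<Sum>i\<in>I. (b i - a i)\<^sup>2) / 8))"
    by (simp add: prod_ennreal exp_sum fin sum_distrib_left sum_divide_distrib)
  finally have bound: "(\<integral>\<^sup>+\<omega>. ennreal (Z \<omega>) \<partial>M) \<le> ennreal (exp (s\<^sup>2 * (\<Sum>i\<in>I. (b i - a i)\<^sup>2) / 8))" .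
  have Z_nonneg: "Z \<omega> \<ge> 0" for \<omega>
    by (simp add: Z_def)
  show int: "integrable M Z"
    by (rule integrableI_nonneg)
       (use bound Z_nonneg in \<open>auto intro: le_less_trans\<close>)
  show "expectation Z \<le> exp (s\<^sup>2 * (\<Sum>i\<in>I. (b i - a i)\<^sup>2) / 8)"
    using bound nn_integral_eq_integral[OF int] Z_nonneg by simp
qed

theorem theorem3p7:
  fixes M :: "'a measure"
    and X :: "nat \<Rightarrow> 'a \<Rightarrow> real"
    and a b lam :: "nat \<Rightarrow> real"
    and N n :: nat
  assumes "prob_space M"
    and "1 \<le> N"
    and "prob_space.indep_vars M (\<lambda>_. borel) X {1..N}"
    and "\<And>i. i \<in> {1..N} \<Longrightarrow> AE \<omega> in M. X i \<omega> \<in> {a i..b i}"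
    and "1 \<le> n"
    and "0 < lam 1"
    and "strict_mono_on {1..n} lam"
  shows "(\<Sum>k=1..n.
            (exp ((lam k - lam 1) * (4 * lam 1 / (\<Sum>i=1..N. (b i - a i)\<^sup>2)))
             - (if k = 1 then 0
                else exp ((lam (k - 1) - lam 1) * (4 * lam 1 / (\<Sum>i=1..N. (b i - a i)\<^sup>2)))))
            * measure M {\<omega> \<in> space M.
                (\<Sum>i=1..N. X i \<omega>) - (\<integral>\<omega>'. (\<Sum>i=1..N. X i \<omega>') \<partial>M) \<ge> lam k})
         \<le> exp (- (2 * (lam 1)\<^sup>2 / (\<Sum>i=1..N. (b i - a i)\<^sup>2)))"
proof -
  interpret indep_interval_bounded_random_variables M "{1..N}" X a b
    using assms(1,3,4)
    by (simp add: indep_interval_bounded_random_variables_def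
        indep_interval_bounded_random_variables_axioms_def)
  define D where "D = (\<Sum>i=1..N. (b i - a i)\<^sup>2)"
  define s where "s = 4 * lam 1 / D"
  define g where "g = (\<lambda>x. exp ((x - lam 1) * s))"
  define Y where "Y = (\<lambda>\<omega>. (\<Sum>i=1..N. X i \<omega>) - expectation (\<lambda>\<omega>. \<Sum>i=1..N. X i \<omega>))"
  have "D \<ge> 0"
    by (simp add: D_def sum_nonneg)
  then have "s \<ge> 0"
    using assms(6) by (simp add: s_def)
  have "integrable M (X i)" if "i \<in> {1..N}" for i
    using interval_bounded_random_variable.integrable bounded_random_variable that by blast
  then have Y_eq: "Y = (\<lambda>\<omega>. \<Sum>i=1..N. X i \<omega> - expectation (X i))"
    by (simp add: Y_def fun_eq_iff sum_subtractf)
  have g_Y: "g (Y \<omega>) = exp (- s * lam 1) * exp (s * Y \<omega>)" for \<omega>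
    by (simp add: g_def algebra_simps flip: exp_add)
  have int: "integrable M (\<lambda>\<omega>. exp (s * Y \<omega>))"
    and mgf: "expectation (\<lambda>\<omega>. exp (s * Y \<omega>)) \<le> exp (s\<^sup>2 * D / 8)"
    using expectation_exp_centred_sum_le[OF \<open>s \<ge> 0\<close>] by (simp_all add: Y_eq D_def)
  have "(\<Sum>k=1..n. (g (lam k) - (if k = 1 then 0 else g (lam (k - 1))))
          * prob {\<omega> \<in> space M. lam k \<le> Y \<omega>}) \<le> expectation (\<lambda>\<omega>. g (Y \<omega>))"
  proof (rule weighted_tail_sum_le_expectation)
    show "mono_on {1..n} lam"
      using assms(7) by (rule strict_mono_on_imp_mono_on)
    show "mono g"
      using \<open>s \<ge> 0\<close> by (auto simp: g_def intro!: monoI mult_right_mono)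
    show "random_variable borel Y"
      unfolding Y_def by measurable
    show "integrable M (\<lambda>\<omega>. g (Y \<omega>))"
      unfolding g_Y using int by simp
  qed (simp add: g_def)
  also have "\<dots> = exp (- s * lam 1) * expectation (\<lambda>\<omega>. exp (s * Y \<omega>))"
    unfolding g_Y by simp
  also have "\<dots> \<le> exp (- s * lam 1) * exp (s\<^sup>2 * D / 8)"
    using mgf by (intro mult_left_mono) auto
  also have "\<dots> = exp (- (2 * (lam 1)\<^sup>2 / D))"
  proof -
    \<comment> \<open>If \<open>D = 0\<close>, then \<open>s = 0\<close> because division by zero yields zero, and both sides are \<open>1\<close>.\<close>
    have "- s * lam 1 + s\<^sup>2 * D / 8 = - (2 * (lam 1)\<^sup>2 / D)"
      by (cases "D = 0") (simp_all add: s_def field_simps power2_eq_square)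
    then show ?thesis
      by (simp flip: exp_add)
  qed
  finally show ?thesis
    unfolding g_def Y_def s_def D_def .
qed

end
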